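(* Let $R=\mathcal{O}_{\mathbb{Q}(\sqrt{-11})}$ and $\alpha=\frac12+\frac{\sqrt{-11}}{2}$. Every maximal connected cyclotomic $\mathcal{L}$-graph over $R$ that is not equivalent to a charged signed graph is equivalent to one of: $S_2$ (two uncharged vertices joined by an edge of label $2$); $S_2'$ (vertex $1$ of charge $+1$, vertex $2$ of charge $-1$, edge $\{1,2\}$ of label $\alpha$); or $S_4'$ (four uncharged vertices, edges $\{1,2\}$ label $\alpha$, $\{3,4\}$ label $-\alpha$, $\{1,3\}$ label $1$, $\{2,4\}$ label $1$).
   Context: Let $d<0$ be squarefree, $R=\mathcal{O}_{\mathbb{Q}(\sqrt{d})}$, and for $n\ge1$ let $\mathcal{L}_n=\{x\in R: x\bar x=n\}$, $\mathcal{L}=\{0\}\cup\mathcal{L}_1\cup\mathcal{L}_2\cup\mathcal{L}_3\cup\mathcal{L}_4$. A (charged) $\mathcal{L}$-graph on $n$ vertices is identified with an $n\times n$ Hermitian matrix $A$ whose diagonal entries (charges) lie in $\{0,1,-1\}$ and whose off-diagonal entries lie in $\mathcal{L}$. An edge $\{i,j\}$ with $i<j$ and label $x$ means $A_{ij}=x$, $A_{ji}=\bar x$; unlisted off-diagonal entries are $0$. The graph is cyclotomic if all eigenvalues of $A$ lie in $[-2,2]$, connected if $A$ is not permutation-similar to a block diagonal matrix with more than one block. $H$ is contained in $G$ if the matrix of $H$ is obtained from that of $G$ by deleting some rows and the corresponding columns. A connected cyclotomic $\mathcal{L}$-graph is maximal if it is not contained in a strictly larger connected cyclotomic $\mathcal{L}$-graph.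 Matrices $A,A'$ are equivalent if $A'=DPXP^{T}D$ for some $X\in\{A,-A,\bar A,-\bar A\}$, permutation matrix $P$ and diagonal matrix $D$ with diagonal entries $\pm1$. A charged signed graph is an $\mathcal{L}$-graph all of whose entries lie in $\{0,1,-1\}$. *)

theory Defs
  imports
    "HOL-Computational_Algebra.Polynomial"
    "Jordan_Normal_Form.Char_Poly"
    "Jordan_Normal_Form.Schur_Decomposition"
    "Jordan_Normal_Form.DL_Submatrix"
begin

definition quadratic_field :: "int \<Rightarrow> complex set" where
  "quadratic_field d = {of_rat a + of_rat b * csqrt (of_int d) | a b. True}"

definition ring_of_integers :: "int \<Rightarrow> complex set" where
  "ring_of_integers d = {x \<in> quadratic_field d. algebraic_int x}"

definition norm_layer :: "int \<Rightarrow> nat \<Rightarrow> complex set" where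
  "norm_layer d n = {x \<in> ring_of_integers d. x * cnj x = of_nat n}"

definition labels :: "int \<Rightarrow> complex set" where
  "labels d = {0} \<union> norm_layer d 1 \<union> norm_layer d 2 \<union> norm_layer d 3 \<union> norm_layer d 4"

text \<open>Graphs are identified with their matrices; a graph has at least one vertex.
  The vertices \<open>1, \<dots>, n\<close> are the indices \<open>0, \<dots>, n - 1\<close>.\<close>

definition L_graph :: "int \<Rightarrow> complex mat \<Rightarrow> bool" where
  "L_graph d A \<longleftrightarrow>
     square_mat A \<and> 0 < dim_row A \<and> mat_adjoint A = A \<and>
     (\<forall>i < dim_row A. A $$ (i, i) \<in> {0, 1, -1}) \<and>
     (\<forall>i < dim_row A. \<forall>j < dim_row A. i \<noteq> j \<longrightarrow> A $$ (i, j) \<in> labels d)"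

definition charged_signed_graph :: "int \<Rightarrow> complex mat \<Rightarrow> bool" where
  "charged_signed_graph d A \<longleftrightarrow>
     L_graph d A \<and> (\<forall>i < dim_row A. \<forall>j < dim_row A. A $$ (i, j) \<in> {0, 1, -1})"

definition cyclotomic :: "complex mat \<Rightarrow> bool" where
  "cyclotomic A \<longleftrightarrow> (\<forall>k. eigenvalue A k \<longrightarrow> k \<in> complex_of_real ` {-2..2})"

definition permutation_mat :: "nat \<Rightarrow> complex mat \<Rightarrow> bool" where
  "permutation_mat n P \<longleftrightarrow>
     (\<exists>p. p permutes {0..<n} \<and> P = mat n n (\<lambda>(i, j). if j = p i then 1 else 0))"

definition sign_mat :: "nat \<Rightarrow> complex mat \<Rightarrow> bool" where
  "sign_mat n D \<longleftrightarrow>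
     D \<in> carrier_mat n n \<and> diagonal_mat D \<and> (\<forall>i < n. D $$ (i, i) \<in> {1, -1})"

definition graph_connected :: "complex mat \<Rightarrow> bool" where
  "graph_connected A \<longleftrightarrow>
     \<not> (\<exists>P Bs. permutation_mat (dim_row A) P \<and> length Bs > 1 \<and>
          (\<forall>B \<in> set Bs. square_mat B \<and> 0 < dim_row B) \<and>
          P * A * transpose_mat P = diag_block_mat Bs)"

definition contained_in :: "complex mat \<Rightarrow> complex mat \<Rightarrow> bool" where
  "contained_in H G \<longleftrightarrow> (\<exists>I \<subseteq> {0..<dim_row G}. H = submatrix G I I)"

definition maximal_connected_cyclotomic :: "int \<Rightarrow> complex mat \<Rightarrow> bool" where
  "maximal_connected_cyclotomic d H \<longleftrightarrow>
     L_graph d H \<and> graph_connected H \<and> cyclotomic H \<and>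
     \<not> (\<exists>G. L_graph d G \<and> graph_connected G \<and> cyclotomic G \<and>
          dim_row H < dim_row G \<and> contained_in H G)"

definition equivalent :: "complex mat \<Rightarrow> complex mat \<Rightarrow> bool" where
  "equivalent A A' \<longleftrightarrow>
     (\<exists>X P D. X \<in> {A, - A, map_mat cnj A, - map_mat cnj A} \<and>
        permutation_mat (dim_row A) P \<and> sign_mat (dim_row A) D \<and>
        A' = D * P * X * transpose_mat P * D)"

definition \<alpha> :: complex where
  "\<alpha> = 1 / 2 + csqrt (- 11) / 2"

definition S2 :: "complex mat" where
  "S2 = mat_of_rows_list 2
     [[0, 2],
      [2, 0]]"

definition S2' :: "complex mat" where
  "S2' = mat_of_rows_list 2
     [[1,         \<alpha>],
      [cnj \<alpha>, -1]]"

definition S4' :: "complex mat" where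
  "S4' = mat_of_rows_list 4
     [[0,         \<alpha>, 1,             0],
      [cnj \<alpha>, 0,     0,             1],
      [1,         0,     0,             - \<alpha>],
      [0,         1,     - cnj \<alpha>,  0]]"

end

theory Submission
  imports Defs
    "Jordan_Normal_Form.Spectral_Radius"
    "HOL-Computational_Algebra.Polynomial_Factorial"
begin

text \<open>
  The labels over the integers of the field with \<open>d = -11\<close> are \<open>0, \<plusminus>1, \<plusminus>2\<close> and the elements
  \<open>\<plusminus>\<alpha>\<close>, \<open>\<plusminus>cnj \<alpha>\<close> of norm 3.
  A cyclotomic matrix satisfies \<open>A\<^sup>2 \<le> 4\<close>, so every row has squared norm at most 4, and a row
  of squared norm 4 is orthogonal to all others. An edge of label \<open>\<plusminus>2\<close> therefore exhausts both its
  ends and gives \<open>S\<^sub>2\<close>. Each end of an edge of norm 3 has room for one more entry of modulus 1. If that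
  is a charge at one end, orthogonality forces the opposite charge at the other end, which gives
  \<open>S\<^sub>2'\<close>. If both ends have a further neighbour, orthogonality closes the square to
  \<open>S\<^sub>4'\<close>. Otherwise the graph has two or three vertices and lies in a copy of \<open>S\<^sub>4'\<close>, so it is not
  maximal.
\<close>

section \<open>Connectedness and equivalence\<close>

lemma list_permutes:
  assumes "distinct xs" "set xs = {0..<n}"
  shows "(\<lambda>i. if i < n then xs ! i else i) permutes {0..<n}"
proof -
  have len: "length xs = n"
    using assms distinct_card by fastforce
  have "bij_betw ((!) xs) {0..<n} {0..<n}"
    using bij_betw_nth[OF assms(1), of "{..<length xs}" "set xs"] assms(2) len
    by (simp add: atLeast0LessThan)
  then have "bij_betw (\<lambda>i. if i < n then xs ! i else i) {0..<n} {0..<n}"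
    by (rule bij_betw_cong[THEN iffD1, rotated]) auto
  then show ?thesis
    by (rule bij_imp_permutes) auto
qed

lemma permutation_conjugate:
  fixes X :: "complex mat"
  assumes p: "p permutes {0..<n}" and X: "X \<in> carrier_mat n n"
  defines "P \<equiv> mat n n (\<lambda>(i, j). if j = p i then 1 else 0)"
  shows "P * X * transpose_mat P = mat n n (\<lambda>(i, j). X $$ (p i, p j))"
proof (rule eq_matI)
  fix i j
  assume "i < dim_row (mat n n (\<lambda>(i, j). X $$ (p i, p j)))"
    "j < dim_col (mat n n (\<lambda>(i, j). X $$ (p i, p j)))"
  then have i: "i < n" and j: "j < n" by auto
  have pl: "p k < n" if "k < n" for k
    using permutes_in_image[OF p, of k] that by auto
  have PX: "(P * X) $$ (i, k) = X $$ (p i, k)" if "k < n" for k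
    using X i that pl[OF i]
    by (simp add: P_def scalar_prod_def if_distrib[of "\<lambda>c. c * _"] cong: if_cong)
  show "(P * X * transpose_mat P) $$ (i, j) = mat n n (\<lambda>(i, j). X $$ (p i, p j)) $$ (i, j)"
  proof -
    have "(P * X * transpose_mat P) $$ (i, j) = (\<Sum>k = 0..<n. (P * X) $$ (i, k) * P $$ (j, k))"
      using X i j by (simp add: P_def scalar_prod_def)
    also have "\<dots> = (\<Sum>k = 0..<n. if k = p j then X $$ (p i, k) else 0)"
      using j by (intro sum.cong) (auto simp: PX, auto simp: P_def)
    finally show ?thesis using pl[OF j] i j by simp
  qed
qed (auto simp: P_def)

text \<open>Listing \<open>S\<close> before its complement conjugates \<open>A\<close> to two
  diagonal blocks, which connectedness forbids when \<open>S\<close> is proper. Local information on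
  rows thus determines the whole vertex set.\<close>

lemma graph_connected_closed_subset:
  assumes A: "A \<in> carrier_mat n n" and conn: "graph_connected A"
    and S: "S \<subseteq> {0..<n}" "S \<noteq> {}"
    and closed: "\<And>i j. i \<in> S \<Longrightarrow> j < n \<Longrightarrow> j \<notin> S \<Longrightarrow> A $$ (i, j) = 0 \<and> A $$ (j, i) = 0"
  shows "S = {0..<n}"
proof (rule ccontr)
  assume ne: "S \<noteq> {0..<n}"
  define T where "T = {0..<n} - S"
  define xs where "xs = sorted_list_of_set S @ sorted_list_of_set T"
  have fin: "finite S" "finite T"
    using S finite_subset by (auto simp: T_def)
  have xs: "distinct xs" "set xs = {0..<n}"
    using fin S by (auto simp: xs_def T_def)
  define p where "p = (\<lambda>i. if i < n then xs ! i else i)"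
  note p = list_permutes[OF xs, folded p_def]
  define m where "m = card S"
  have len: "length xs = n"
    using xs distinct_card by fastforce
  have m: "0 < m" "m < n"
    using fin S ne psubset_card_mono[of "{0..<n}" S] by (auto simp: m_def card_gt_0_iff)
  have pS: "p i \<in> S" if "i < m" for i
    using that m fin nth_mem[of i "sorted_list_of_set S"]
    by (auto simp: p_def xs_def nth_append m_def)
  have pT: "p i < n \<and> p i \<notin> S" if "m \<le> i" "i < n" for i
  proof -
    have "i - m < length (sorted_list_of_set T)"
      using that len by (auto simp: xs_def m_def)
    from nth_mem[OF this] have "sorted_list_of_set T ! (i - m) \<in> T"
      using fin by simp
    then show ?thesis
      using that by (auto simp: p_def xs_def nth_append m_def T_def)
  qed
  define B where "B = mat m m (\<lambda>(i, j). A $$ (p i, p j))"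
  define C where "C = mat (n - m) (n - m) (\<lambda>(i, j). A $$ (p (i + m), p (j + m)))"
  define P :: "complex mat" where "P = mat n n (\<lambda>(i, j). if j = p i then 1 else 0)"
  have "P * A * transpose_mat P = diag_block_mat [B, C]"
    unfolding P_def permutation_conjugate[OF p A]
  proof (rule eq_matI)
    fix i j
    assume "i < dim_row (diag_block_mat [B, C])" "j < dim_col (diag_block_mat [B, C])"
    then have ij: "i < n" "j < n"
      using m by (auto simp: Let_def B_def C_def)
    consider "i < m" "j < m" | "i < m" "m \<le> j" | "m \<le> i" "j < m" | "m \<le> i" "m \<le> j"
      by linarith
    then show "mat n n (\<lambda>(i, j). A $$ (p i, p j)) $$ (i, j) = diag_block_mat [B, C] $$ (i, j)"
      using ij m closed[of "p i" "p j"] closed[of "p j" "p i"] pS pT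
      by cases (auto simp: Let_def B_def C_def)
  qed (use m in \<open>auto simp: Let_def B_def C_def\<close>)
  moreover have "permutation_mat (dim_row A) P"
    using A p by (auto simp: permutation_mat_def P_def)
  ultimately show False
    using conn m unfolding graph_connected_def
    by (elim notE, intro exI[of _ P] exI[of _ "[B, C]"] conjI) (simp_all add: B_def C_def)
qed

text \<open>The indices of the first block of a decomposition, carried back by the permutation,
  would form a proper closed set. This is how the larger graph in a refutation of maximality is
  shown to be connected.\<close>

lemma graph_connectedI:
  assumes A: "A \<in> carrier_mat n n"
    and closed: "\<And>S. S \<subseteq> {0..<n} \<Longrightarrow> S \<noteq> {} \<Longrightarrow>
      (\<And>i j. i \<in> S \<Longrightarrow> j < n \<Longrightarrow> j \<notin> S \<Longrightarrow> A $$ (i, j) = 0) \<Longrightarrow> S = {0..<n}"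
  shows "graph_connected A"
  unfolding graph_connected_def
proof (rule notI, elim exE conjE)
  fix P Bs
  assume P: "permutation_mat (dim_row A) P" and len: "1 < length Bs"
    and sq: "\<forall>B \<in> set Bs. square_mat B \<and> 0 < dim_row B"
    and eq: "P * A * transpose_mat P = diag_block_mat Bs"
  obtain p where p: "p permutes {0..<n}"
    and P_eq: "P = mat n n (\<lambda>(i, j). if j = p i then 1 else 0)"
    using P A by (auto simp: permutation_mat_def)
  obtain B C Cs where Bs: "Bs = B # C # Cs"
    using len by (cases Bs rule: remdups_adj.cases) auto
  \<comment> \<open>Merging all blocks after the first reduces to a 2 by 2 block shape.\<close>
  define M where "M = diag_block_mat (C # Cs)"
  define m where "m = dim_row B"
  have B: "B \<in> carrier_mat m m"
    using sq by (auto simp: m_def Bs)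
  have "square_mat M"
    unfolding M_def by (rule diag_block_mat_square) (use sq Bs in auto)
  then have M: "M \<in> carrier_mat (dim_row M) (dim_row M)" by auto
  have M0: "0 < dim_row M"
    using sq by (simp add: M_def Bs Let_def)
  have Q: "mat n n (\<lambda>(i, j). A $$ (p i, p j)) =
      four_block_mat B (0\<^sub>m m (dim_row M)) (0\<^sub>m (dim_row M) m) M"
    using eq M B unfolding P_eq permutation_conjugate[OF p A] Bs diag_block_mat.simps(2)[of B]
      M_def[symmetric] Let_def by (metis carrier_matD)
  then have n: "n = m + dim_row M"
    using B by (metis carrier_matD(1) dim_row_mat(1) index_mat_four_block(2))
  have m0: "0 < m"
    using sq by (simp add: m_def Bs)
  have zero: "A $$ (p i, p j) = 0" if "i < m" "m \<le> j" "j < n" for i j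
  proof -
    have "A $$ (p i, p j) = mat n n (\<lambda>(i, j). A $$ (p i, p j)) $$ (i, j)"
      using that n by simp
    also have "\<dots> = 0"
      unfolding Q using that n carrier_matD[OF B] carrier_matD(2)[OF M] by simp
    finally show ?thesis .
  qed
  have "p ` {0..<m} = {0..<n}"
  proof (rule closed)
    show "p ` {0..<m} \<subseteq> {0..<n}"
      using permutes_image[OF p] n by auto
  next
    show "p ` {0..<m} \<noteq> {}" using m0 by auto
  next
    fix i j assume i: "i \<in> p ` {0..<m}" and j: "j < n" "j \<notin> p ` {0..<m}"
    obtain j' where "j = p j'" "j' < n"
      using permutes_image[OF p] j(1) by (metis atLeastLessThan_iff imageE zero_le)
    then show "A $$ (i, j) = 0"
      using i j zero by (metis atLeastLessThan_iff image_iff not_le_imp_less zero_le)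
  qed
  then have "card {0..<n} \<le> m"
    by (metis card_atLeastLessThan card_image_le diff_zero finite_atLeastLessThan)
  then show False using n M0 by simp
qed

text \<open>Reduces equivalence to data that can be written down, a list of the old vertices in
  their new order and a list of signs, so that each case of the classification becomes a finite
  check of entries.\<close>

lemma equivalentI:
  assumes A: "A \<in> carrier_mat n n" and A': "A' \<in> carrier_mat n n"
    and X: "X \<in> {A, - A, map_mat cnj A, - map_mat cnj A}"
    and xs: "distinct xs" "set xs = {0..<n}"
    and d: "\<And>i. i < n \<Longrightarrow> d i \<in> {1, - 1 :: complex}"
    and eq: "\<And>i j. i < n \<Longrightarrow> j < n \<Longrightarrow> A' $$ (i, j) = d i * d j * X $$ (xs ! i, xs ! j)"
  shows "equivalent A A'"
proof -
  define p where "p = (\<lambda>i. if i < n then xs ! i else i)"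
  note p = list_permutes[OF xs, folded p_def]
  have Xc: "X \<in> carrier_mat n n" using X A by auto
  define P :: "complex mat" where "P = mat n n (\<lambda>(i, j). if j = p i then 1 else 0)"
  define D where "D = mat n n (\<lambda>(i, j). if i = j then d i else 0)"
  define Y where "Y = mat n n (\<lambda>(i, j). X $$ (p i, p j))"
  have DY: "(D * Y) $$ (i, j) = d i * Y $$ (i, j)" if "i < n" "j < n" for i j
    using that
    by (simp add: D_def Y_def scalar_prod_def if_distrib[of "\<lambda>c. c * _"] cong: if_cong)
  have DYD: "D * Y * D = A'"
  proof (rule eq_matI)
    fix i j assume "i < dim_row A'" "j < dim_col A'"
    then have ij: "i < n" "j < n" using A' by auto
    have "(D * Y * D) $$ (i, j) = (\<Sum>k = 0..<n. (D * Y) $$ (i, k) * D $$ (k, j))"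
      using ij by (simp add: D_def Y_def scalar_prod_def)
    also have "\<dots> = (\<Sum>k = 0..<n. if k = j then d i * Y $$ (i, k) * d j else 0)"
      using ij by (intro sum.cong) (auto simp: DY, auto simp: D_def)
    also have "\<dots> = A' $$ (i, j)"
      using ij eq[OF ij] by (simp add: Y_def p_def)
    finally show "(D * Y * D) $$ (i, j) = A' $$ (i, j)" .
  qed (use A' in \<open>auto simp: D_def\<close>)
  have "D \<in> carrier_mat n n" "P \<in> carrier_mat n n"
    by (auto simp: D_def P_def)
  then have "D * P * X * transpose_mat P * D = D * (P * X * transpose_mat P) * D"
    using Xc by (simp add: assoc_mult_mat[of _ n n _ n _ n])
  then have "A' = D * P * X * transpose_mat P * D"
    unfolding P_def permutation_conjugate[OF p Xc] using DYD Y_def by simp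
  moreover have "permutation_mat (dim_row A) P"
    using A p by (auto simp: permutation_mat_def P_def)
  moreover have "sign_mat (dim_row A) D"
    using A d by (auto simp: sign_mat_def D_def diagonal_mat_def)
  ultimately show ?thesis
    using X unfolding equivalent_def by blast
qed

section \<open>Rows of cyclotomic matrices\<close>

definition hermitian_mat :: "nat \<Rightarrow> complex mat \<Rightarrow> bool" where
  "hermitian_mat n A \<longleftrightarrow>
     A \<in> carrier_mat n n \<and> (\<forall>i < n. \<forall>j < n. A $$ (j, i) = cnj (A $$ (i, j)))"

lemma mat_adjoint_index:
  fixes A :: "complex mat"
  assumes "A \<in> carrier_mat n n" "i < n" "j < n"
  shows "mat_adjoint A $$ (i, j) = cnj (A $$ (j, i))"
  using assms by (simp add: mat_adjoint_def mat_of_rows_index)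

lemma mult_index_sum:
  assumes "A \<in> carrier_mat n n" "B \<in> carrier_mat n n" "i < n" "j < n"
  shows "(A * B) $$ (i, j) = (\<Sum>k = 0..<n. A $$ (i, k) * B $$ (k, j))"
  using assms by (simp add: scalar_prod_def)

lemma pow_mat_add:
  assumes "A \<in> carrier_mat n n"
  shows "A ^\<^sub>m (k + l) = A ^\<^sub>m k * A ^\<^sub>m l"
  using assms by (induction l) (auto simp: assoc_mult_mat[of _ n n _ n _ n])

lemma hermitian_mat_square:
  assumes "hermitian_mat n A"
  shows "hermitian_mat n (A * A)"
    and "i < n \<Longrightarrow> (A * A) $$ (i, i) = of_real (\<Sum>j = 0..<n. (cmod (A $$ (i, j)))\<^sup>2)"
proof -
  have A: "A \<in> carrier_mat n n" and h: "\<And>i j. i < n \<Longrightarrow> j < n \<Longrightarrow> A $$ (j, i) = cnj (A $$ (i, j))"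
    using assms unfolding hermitian_mat_def by blast+
  have "(A * A) $$ (j, i) = cnj ((A * A) $$ (i, j))" if "i < n" "j < n" for i j
    unfolding mult_index_sum[OF A A that] mult_index_sum[OF A A that(2,1)] cnj_sum
  proof (rule sum.cong[OF refl])
    fix k assume "k \<in> {0..<n}"
    then have k: "k < n" by simp
    show "A $$ (j, k) * A $$ (k, i) = cnj (A $$ (i, k) * A $$ (k, j))"
      using h[OF k that(2)] h[OF that(1) k] by simp
  qed
  then show "hermitian_mat n (A * A)"
    using A unfolding hermitian_mat_def by (meson mult_carrier_mat)
  assume i: "i < n"
  show "(A * A) $$ (i, i) = of_real (\<Sum>j = 0..<n. (cmod (A $$ (i, j)))\<^sup>2)"
    unfolding mult_index_sum[OF A A i i] of_real_sum
  proof (rule sum.cong[OF refl])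
    fix k assume "k \<in> {0..<n}"
    then have k: "k < n" by simp
    show "A $$ (i, k) * A $$ (k, i) = of_real ((cmod (A $$ (i, k)))\<^sup>2)"
      unfolding h[OF i k] by (simp only: complex_norm_square)
  qed
qed

text \<open>With t = ln r * 2 ^ k the right side is exp t, which outgrows every polynomial in t. The
  exponents are those produced by repeated squaring.\<close>

lemma polynomial_less_exponential:
  fixes r c1 c2 :: real
  assumes "1 < r"
  shows "\<exists>k. c1 + c2 * real (2 * 2 ^ k) ^ m < r ^ (2 ^ k)"
proof -
  have ln: "0 < ln r" using assms by simp
  have exp0: "((\<lambda>x :: real. x ^ j / exp x) \<longlongrightarrow> 0) at_top" for j
    by (rule tendsto_power_div_exp_0)
  have "filterlim (\<lambda>k. real (2 ^ k)) at_top sequentially"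
    by (rule filterlim_at_top_mono[OF filterlim_real_sequentially])
      (auto intro!: always_eventually of_nat_less_two_power less_imp_le)
  then have lim: "filterlim (\<lambda>k. ln r * real (2 ^ k)) at_top sequentially"
    by (rule filterlim_tendsto_pos_mult_at_top[OF tendsto_const ln])
  \<comment> \<open>This is the quotient of the two sides; the factor (2 / ln r) ^ m converts t ^ m
    into (2 * 2 ^ k) ^ m.\<close>
  have "(\<lambda>k. c1 * ((ln r * real (2 ^ k)) ^ 0 / exp (ln r * real (2 ^ k))) +
      c2 * (2 / ln r) ^ m * ((ln r * real (2 ^ k)) ^ m / exp (ln r * real (2 ^ k))))
      \<longlonglongrightarrow> c1 * 0 + c2 * (2 / ln r) ^ m * 0"
    by (intro tendsto_add tendsto_mult tendsto_const filterlim_compose[OF exp0 lim])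
  then have "\<forall>\<^sub>F k in sequentially. c1 * ((ln r * real (2 ^ k)) ^ 0 / exp (ln r * real (2 ^ k))) +
      c2 * (2 / ln r) ^ m * ((ln r * real (2 ^ k)) ^ m / exp (ln r * real (2 ^ k))) < 1"
    by (rule order_tendstoD) simp
  from this obtain k where k: "c1 * ((ln r * real (2 ^ k)) ^ 0 / exp (ln r * real (2 ^ k))) +
      c2 * (2 / ln r) ^ m * ((ln r * real (2 ^ k)) ^ m / exp (ln r * real (2 ^ k))) < 1"
    by (rule exE[OF eventually_happens'[OF sequentially_bot]])
  have e: "exp (ln r * real (2 ^ k)) = r ^ (2 ^ k)"
    unfolding exp_of_nat2_mult using assms by simp
  have p: "(2 / ln r) ^ m * (ln r * real (2 ^ k)) ^ m = real (2 * 2 ^ k) ^ m"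
    unfolding power_mult_distrib[symmetric] using ln by simp
  have "(c1 + c2 * ((2 / ln r) ^ m * (ln r * real (2 ^ k)) ^ m)) / r ^ (2 ^ k) < 1"
    using k unfolding e
    by (simp only: add_divide_distrib power_0 times_divide_eq_right mult_1_right mult.assoc)
  then have "c1 + c2 * real (2 * 2 ^ k) ^ m < r ^ (2 ^ k)"
    unfolding p using assms by (simp add: pos_divide_less_eq)
  then show ?thesis ..
qed

text \<open>Since \<open>(H\<^sup>2)\<^sub>i\<^sub>i = \<Sum>\<^sub>j |H\<^sub>i\<^sub>j|\<^sup>2 \<ge> |H\<^sub>i\<^sub>i|\<^sup>2\<close> for Hermitian \<open>H\<close>, repeated squaring makes the
  \<open>i\<close>-th diagonal entry of the powers of \<open>A\<close> grow at least like the powers of the \<open>i\<close>-th row norm.\<close>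

lemma hermitian_row_norm:
  assumes herm: "hermitian_mat n A" and i: "i < n" and R: "0 < R"
    and bound: "\<And>k. cmod ((A ^\<^sub>m k) $$ (i, i)) \<le> R ^ k * (c1 + c2 * real k ^ m)"
  shows "(\<Sum>j = 0..<n. (cmod (A $$ (i, j)))\<^sup>2) \<le> R\<^sup>2"
proof (rule ccontr)
  define s where "s = (\<Sum>j = 0..<n. (cmod (A $$ (i, j)))\<^sup>2)"
  assume "\<not> (\<Sum>j = 0..<n. (cmod (A $$ (i, j)))\<^sup>2) \<le> R\<^sup>2"
  then have s: "R\<^sup>2 < s" by (simp add: s_def)
  have s0: "0 \<le> s" by (simp add: s_def sum_nonneg)
  have A: "A \<in> carrier_mat n n" using herm by (simp add: hermitian_mat_def)
  have step: "A ^\<^sub>m (2 * k) = (A ^\<^sub>m k) * (A ^\<^sub>m k)" for k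
    using pow_mat_add[OF A, of k k] by (simp add: mult_2)
  have hpow: "hermitian_mat n (A ^\<^sub>m (2 ^ k))" for k
  proof (induction k)
    case 0
    then show ?case using herm A by simp
  next
    case (Suc k)
    then show ?case using hermitian_mat_square(1) step[of "2 ^ k"] by simp
  qed
  have grow: "s ^ (2 ^ k) \<le> cmod ((A ^\<^sub>m (2 * 2 ^ k)) $$ (i, i))" for k
  proof (induction k)
    case 0
    have "A ^\<^sub>m 1 = A" using A by simp
    then show ?case
      using hermitian_mat_square(2)[OF herm i] step[of 1] s0
      by (simp add: s_def[symmetric] del: pow_mat.simps)
  next
    case (Suc k)
    let ?H = "A ^\<^sub>m (2 ^ Suc k)"
    have "s ^ (2 ^ Suc k) = (s ^ (2 ^ k))\<^sup>2"
      by (simp add: power_mult[symmetric] mult.commute)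
    also have "\<dots> \<le> (cmod (?H $$ (i, i)))\<^sup>2"
      using Suc s0 by (intro power_mono) auto
    also have "\<dots> \<le> (\<Sum>j = 0..<n. (cmod (?H $$ (i, j)))\<^sup>2)"
      by (rule member_le_sum[of i]) (use i in auto)
    also have "\<dots> = cmod ((?H * ?H) $$ (i, i))"
      unfolding hermitian_mat_square(2)[OF hpow i] norm_of_real
      by (rule abs_of_nonneg[symmetric]) (simp add: sum_nonneg)
    finally show ?case using step[of "2 ^ Suc k"] by simp
  qed
  \<comment> \<open>Growth and upper bound together would keep the powers of this ratio below a
    polynomial.\<close>
  have r: "1 < s / R\<^sup>2" using s R by simp
  obtain k where k: "c1 + c2 * real (2 * 2 ^ k) ^ m < (s / R\<^sup>2) ^ (2 ^ k)"
    using polynomial_less_exponential[OF r] by blast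
  have "s ^ (2 ^ k) \<le> R ^ (2 * 2 ^ k) * (c1 + c2 * real (2 * 2 ^ k) ^ m)"
    using grow[of k] bound[of "2 * 2 ^ k"] by linarith
  also have "\<dots> < R ^ (2 * 2 ^ k) * (s / R\<^sup>2) ^ (2 ^ k)"
    using k R by simp
  also have "\<dots> = s ^ (2 ^ k)"
    using R by (simp add: power_divide power_mult)
  finally show False by simp
qed

text \<open>Half of \<open>A\<close> has spectral radius at most 1, so its powers grow at most
  polynomially. The polynomial factor is harmless because \<open>hermitian_row_norm\<close> absorbs
  it.\<close>

lemma cyclotomic_power_bound:
  assumes A: "A \<in> carrier_mat n n" and n: "0 < n" and cyc: "cyclotomic A"
  shows "\<exists>c1 c2. \<forall>k. \<forall>i < n. \<forall>j < n.
    cmod ((A ^\<^sub>m k) $$ (i, j)) \<le> 2 ^ k * (c1 + c2 * real k ^ (n - 1))"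
proof -
  define B where "B = (1 / 2 :: complex) \<cdot>\<^sub>m A"
  have B: "B \<in> carrier_mat n n" using A by (simp add: B_def)
  have le_1: "cmod k \<le> 1" if ev: "eigenvalue B k" for k
  proof -
    obtain v where v: "v \<in> carrier_vec n" "v \<noteq> 0\<^sub>v n" "B *\<^sub>v v = k \<cdot>\<^sub>v v"
      using ev carrier_matD(1)[OF B] unfolding eigenvalue_def eigenvector_def by auto
    have "A *\<^sub>v v = (2 * k) \<cdot>\<^sub>v v"
    proof (rule eq_vecI)
      fix i assume "i < dim_vec ((2 * k) \<cdot>\<^sub>v v)"
      then have i: "i < n" using v by simp
      have "(B *\<^sub>v v) $ i = k * v $ i" using v i by simp
      then show "(A *\<^sub>v v) $ i = ((2 * k) \<cdot>\<^sub>v v) $ i"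
        using A v i
        by (simp add: B_def scalar_prod_def mult.assoc sum_divide_distrib[symmetric] field_simps)
    qed (use A v in auto)
    then have "eigenvalue A (2 * k)"
      using v A unfolding eigenvalue_def eigenvector_def by auto
    then obtain x where "2 * k = complex_of_real x" "x \<in> {- 2..2}"
      using cyc unfolding cyclotomic_def by blast
    then have "cmod (2 * k) \<le> 2" by auto
    then show ?thesis by (simp add: norm_mult)
  qed
  have sr: "spectral_radius B \<le> 1"
    using spectral_radius_mem_max(1)[OF B n] le_1 by (auto simp: spectrum_def)
  \<comment> \<open>The multiplicity of any root is at most the degree n, whence the exponent n -
    1.\<close>
  have "Polynomial.order x (char_poly B) \<le> n" for x
  proof -
    have "char_poly B \<noteq> 0"
      using degree_monic_char_poly[OF B] by (metis coeff_0 zero_neq_one)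
    from order_degree[OF this, of x] show ?thesis
      using degree_monic_char_poly[OF B] by simp
  qed
  from spectral_radius_poly_bound[OF B sr this]
  obtain c1 c2 where c: "\<And>k. norm_bound (B ^\<^sub>m k) (c1 + c2 * of_nat k ^ (n - 1))"
    by blast
  have AB: "A ^\<^sub>m k = 2 ^ k \<cdot>\<^sub>m (B ^\<^sub>m k)" for k
  proof (induction k)
    case 0
    then show ?case using A B by (intro eq_matI) auto
  next
    case (Suc k)
    have "A = 2 \<cdot>\<^sub>m B" using A by (auto simp: B_def)
    then have "A ^\<^sub>m Suc k = (2 ^ k \<cdot>\<^sub>m (B ^\<^sub>m k)) * (2 \<cdot>\<^sub>m B)"
      using Suc by simp
    also have "\<dots> = 2 ^ Suc k \<cdot>\<^sub>m (B ^\<^sub>m k * B)"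
      using B by (subst mult_smult_distrib[of _ n n _ n], simp_all,
          subst mult_smult_assoc_mat[of _ n n _ n], simp_all add: mult.assoc)
        (rule eq_matI, auto)
    finally show ?case by simp
  qed
  have "cmod ((A ^\<^sub>m k) $$ (i, j)) \<le> 2 ^ k * (c1 + c2 * real k ^ (n - 1))"
    if "i < n" "j < n" for i j k
    using c[of k] that B unfolding norm_bound_def AB by (simp add: norm_mult norm_power)
  then show ?thesis by blast
qed

text \<open>The growth argument with R = 2 bounds the rows of \<open>A\<close>, and with R = 4 the
  rows of \<open>A * A\<close>. If row i has squared norm 4, the diagonal entry 4 of
  \<open>A * A\<close> already exhausts the bound 16, so the rest of that row vanishes.\<close>

lemma cyclotomic_row_norm:
  assumes herm: "hermitian_mat n A" and cyc: "cyclotomic A" and i: "i < n"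
  shows "(\<Sum>j = 0..<n. (cmod (A $$ (i, j)))\<^sup>2) \<le> 4"
    and "(\<Sum>j = 0..<n. (cmod (A $$ (i, j)))\<^sup>2) = 4 \<Longrightarrow> k < n \<Longrightarrow> k \<noteq> i \<Longrightarrow> (A * A) $$ (i, k) = 0"
proof -
  have A: "A \<in> carrier_mat n n" using herm by (simp add: hermitian_mat_def)
  obtain c1 c2 where c: "\<And>k. cmod ((A ^\<^sub>m k) $$ (i, i)) \<le> 2 ^ k * (c1 + c2 * real k ^ (n - 1))"
  proof -
    have "0 < n" using i by simp
    from cyclotomic_power_bound[OF A this cyc] show thesis using that i by blast
  qed
  show "(\<Sum>j = 0..<n. (cmod (A $$ (i, j)))\<^sup>2) \<le> 4"
    using hermitian_row_norm[OF herm i zero_less_numeral c] by simp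
  assume four: "(\<Sum>j = 0..<n. (cmod (A $$ (i, j)))\<^sup>2) = 4" and k: "k < n" "k \<noteq> i"
  have AA: "(A * A) ^\<^sub>m k = A ^\<^sub>m (2 * k)" for k
  proof (induction k)
    case (Suc k)
    have "A ^\<^sub>m (2 * Suc k) = A ^\<^sub>m (2 * k) * (A * A)"
      using A by (simp add: assoc_mult_mat[of _ n n _ n _ n])
    then show ?case using Suc by simp
  qed (use A in simp)
  have "cmod (((A * A) ^\<^sub>m k) $$ (i, i)) \<le> 4 ^ k * (c1 + (c2 * 2 ^ (n - 1)) * real k ^ (n - 1))" for k
    using c[of "2 * k"] unfolding AA by (simp add: power_mult power_mult_distrib mult.assoc)
  from hermitian_row_norm[OF hermitian_mat_square(1)[OF herm] i zero_less_numeral this]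
  have le: "(\<Sum>j = 0..<n. (cmod ((A * A) $$ (i, j)))\<^sup>2) \<le> 16" by simp
  have "(\<Sum>j \<in> {i, k}. (cmod ((A * A) $$ (i, j)))\<^sup>2) \<le> (\<Sum>j = 0..<n. (cmod ((A * A) $$ (i, j)))\<^sup>2)"
    by (rule sum_mono2) (use i k in auto)
  then have "(cmod ((A * A) $$ (i, i)))\<^sup>2 + (cmod ((A * A) $$ (i, k)))\<^sup>2 \<le> 16"
    using le k by simp
  then show "(A * A) $$ (i, k) = 0"
    using hermitian_mat_square(2)[OF herm i] four by simp
qed

section \<open>Labels\<close>

text \<open>Gauss' lemma: the primitive integral multiple of the minimal polynomial of \<open>x\<close> divides a monic
  integral polynomial, hence is monic itself.\<close>

lemma quadratic_algebraic_int_trace: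
  assumes "algebraic_int x" "Im x \<noteq> 0" "x * cnj x = of_int n" "2 * Re x \<in> \<rat>"
  shows "2 * Re x \<in> \<int>"
proof -
  obtain p q :: int where q: "0 < q" "coprime p q" and pq: "2 * Re x = of_int p / of_int q"
    using Rats_cases'[OF assms(4)] by metis
  obtain f :: "int poly" where f: "poly (map_poly of_int f) x = 0" "lead_coeff f = 1"
    using assms(1) unfolding algebraic_int_altdef_ipoly by blast
  \<comment> \<open>This is q times the monic real quadratic with roots x and its conjugate.\<close>
  define g where "g = [:q * n, - p, q:]"
  have lg: "lead_coeff g = q" "degree g = 2" "g \<noteq> 0"
    using q by (auto simp: g_def)
  have "content g dvd q" "content g dvd - p"
    using content_dvd_coeff[of g 1] content_dvd_coeff[of g 2]
    by (simp_all add: g_def numeral_2_eq_2)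
  then have "is_unit (content g)"
    using q(2) by (metis coprime_common_divisor dvd_minus_iff)
  then have cg: "content g = 1"
    by (metis is_unit_normalize normalize_content)
  have "of_int p = of_int q * (x + cnj x)"
    using pq q by (simp add: complex_eq_iff field_simps)
  then have gx: "poly (map_poly of_int g) x = 0"
    using assms(3) unfolding g_def of_int_hom.map_poly_pCons_hom by (simp add: algebra_simps)
  \<comment> \<open>Pseudo-division stays over the integers at the price of the factor c. The
    remainder has degree at most 1 and a non-real root, so it is 0.\<close>
  obtain h r where hr: "pseudo_divmod f g = (h, r)" by fastforce
  define c where "c = q ^ (Suc (degree f) - degree g)"
  have fgh: "smult c f = g * h + r" and r: "r = 0 \<or> degree r < 2"
    using pseudo_divmod[OF lg(3) hr] lg by (auto simp: c_def)
  have c0: "0 < c" using q by (simp add: c_def)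
  have "poly (map_poly of_int (smult c f)) x = poly (map_poly of_int (g * h + r)) x"
    using fgh by simp
  then have rx: "poly (map_poly of_int r) x = 0"
    using f gx by (simp add: hom_distribs)
  have "degree r \<le> 1" using r by auto
  then have "r = [:coeff r 0, coeff r 1:]"
    by (intro poly_eqI) (auto simp: coeff_pCons coeff_eq_0 split: nat.split)
  then have "of_int (coeff r 0) + x * of_int (coeff r 1) = 0"
    using rx by (metis of_int_hom.map_poly_pCons_hom poly_pCons map_poly_0 poly_0
        add.right_neutral mult_zero_right)
  then have "r = 0"
    using assms(2) \<open>r = [:coeff r 0, coeff r 1:]\<close> by (auto simp: complex_eq_iff)
  then have fgh: "smult c f = g * h" using fgh by simp
  have "content f dvd 1" using content_dvd_coeff[of f "degree f"] f(2) by simp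
  then have cf: "content f = 1" by (metis is_unit_normalize normalize_content)
  \<comment> \<open>Contents are multiplicative and f, g are primitive. Hence c divides the leading
    coefficient of h, while c is q times that coefficient, and this forces q = 1.\<close>
  have "content h = c"
    using arg_cong[OF fgh, of content] c0 by (simp add: content_mult cg cf)
  then have "c dvd lead_coeff h" by (metis content_dvd_coeff)
  moreover have "c = q * lead_coeff h"
    using arg_cong[OF fgh, of lead_coeff] f(2) lg(1) c0 by (simp add: lead_coeff_mult)
  ultimately obtain k where "c = q * (c * k)" by (auto simp: dvd_def)
  then have "c * (q * k) = c * 1" by (simp add: algebra_simps)
  then have "q * k = 1" using c0 by simp
  then have "q = 1" using q by (simp add: pos_zmult_eq_1_iff)
  then show ?thesis using pq by simp
qed

section \<open>The finite list of labels for d = -11\<close>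

lemma csqrt_minus_11: "csqrt (- 11) = \<i> * sqrt 11"
  using csqrt_of_real_nonpos[of "- 11"] by simp

lemma \<alpha>_eq: "\<alpha> = Complex (1 / 2) (sqrt 11 / 2)"
  by (simp add: \<alpha>_def csqrt_minus_11 complex_eq_iff)

lemma cmod_\<alpha>: "(cmod \<alpha>)\<^sup>2 = 3"
  by (simp add: \<alpha>_eq cmod_power2 power_divide)

text \<open>Writing x = (t + e * sqrt (-11)) / 2 with integers t, e turns the norm condition into
  t^2 + 11 e^2 = 4n, at most 16. There is no solution for n = 2.\<close>

lemma labels_minus_11:
  assumes "x \<in> labels (- 11)"
  shows "x \<in> {0, 1, - 1, 2, - 2, \<alpha>, - \<alpha>, cnj \<alpha>, - cnj \<alpha>}"
proof (cases "x = 0")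
  case False
  then obtain n :: nat where n: "n \<in> {1, 2, 3, 4}" and x: "x \<in> ring_of_integers (- 11)" "x * cnj x = of_nat n"
  proof -
    have "\<exists>n \<in> {1, 2, 3, 4 :: nat}. x \<in> norm_layer (- 11) n"
      using assms False unfolding labels_def by blast
    then show thesis using that unfolding norm_layer_def by blast
  qed
  obtain a b where ab: "x = of_rat a + of_rat b * csqrt (of_int (- 11))" and alg: "algebraic_int x"
    using x(1) by (auto simp: ring_of_integers_def quadratic_field_def)
  have rat: "of_rat r = complex_of_real (of_rat r)" for r
    by (cases r) (simp add: of_rat_rat)
  have "x = Complex (of_rat a) (of_rat b * sqrt 11)"
    unfolding ab by (simp add: csqrt_minus_11 rat complex_eq_iff)
  then have Re: "Re x = of_rat a" and Im: "Im x = of_rat b * sqrt 11"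
    by simp_all
  have nrm: "(of_rat a)\<^sup>2 + 11 * (of_rat b)\<^sup>2 = real n"
    using arg_cong[OF x(2), of Re] by (simp add: Re Im flip: power2_eq_square)
      (simp add: power_mult_distrib)
  have "2 * Re x \<in> \<int>"
  proof (cases "Im x = 0")
    case True
    then have "x = of_rat a" using Re by (simp add: rat complex_eq_iff)
    then have "x \<in> \<rat>" by (metis Rats_of_rat)
    then have "x \<in> \<int>" using alg rational_algebraic_int_is_int by blast
    then show ?thesis by (auto elim!: Ints_cases)
  next
    case False
    show ?thesis
      by (rule quadratic_algebraic_int_trace[OF alg False, of "int n"]) (use x(2) Re in auto)
  qed
  then obtain t :: int where t: "2 * Re x = of_int t" by (auto elim: Ints_cases)
  \<comment> \<open>The factor 22 makes the square equal to 11 (4n - t^2). So c is a rational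
    algebraic integer, hence an integer; it is then divisible by 11, which leaves b = e / 2.\<close>
  define c :: real where "c = 22 * of_rat b"
  have c2: "c\<^sup>2 = of_int (11 * (4 * int n - t\<^sup>2))"
  proof -
    have t: "real_of_int t = 2 * of_rat a" using t Re by simp
    have "c\<^sup>2 = 484 * (of_rat b)\<^sup>2" by (simp add: c_def power_mult_distrib)
    also have "\<dots> = 11 * (4 * real n - (2 * of_rat a)\<^sup>2)"
      using nrm by (simp add: power_mult_distrib)
    finally show ?thesis using t by simp
  qed
  have "algebraic_int (c\<^sup>2)" unfolding c2 by (rule int_imp_algebraic_int) simp
  then have "algebraic_int c"
    by (rule algebraic_int_root[where p = "monom 1 2"]) (auto simp: poly_monom degree_monom_eq)
  moreover have "c \<in> \<rat>" by (simp add: c_def)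
  ultimately have "c \<in> \<int>" using rational_algebraic_int_is_int by blast
  then obtain d :: int where d: "c = of_int d" by (auto elim: Ints_cases)
  have d2: "d\<^sup>2 = 11 * (4 * int n - t\<^sup>2)"
    using c2 unfolding d by (metis of_int_eq_iff of_int_power)
  then have "11 dvd d"
    using prime_dvd_power[of "11 :: int" d 2] by simp
  then obtain e where e: "d = 11 * e" by (auto simp: dvd_def)
  have e2: "11 * e\<^sup>2 + t\<^sup>2 = 4 * int n"
    using d2 unfolding e by (simp add: power2_eq_square)
  have Im': "Im x = of_int e / 2 * sqrt 11"
    using d Im by (simp add: c_def e field_simps)
  have "11 * e\<^sup>2 \<le> 16" "t\<^sup>2 \<le> 16" 
  proof -
    have "11 * e\<^sup>2 + t\<^sup>2 \<le> 16" using e2 n by auto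
    then show "11 * e\<^sup>2 \<le> 16" "t\<^sup>2 \<le> 16"
      using zero_le_power2[of e] zero_le_power2[of t] by linarith+
  qed
  then have "e\<^sup>2 < 2\<^sup>2" "t\<^sup>2 < 5\<^sup>2" by simp_all
  then have "\<bar>e\<bar> < 2" "\<bar>t\<bar> < 5"
    using power2_less_imp_less[of "\<bar>e\<bar>" 2] power2_less_imp_less[of "\<bar>t\<bar>" 5] by simp_all
  then have et: "e \<in> {- 1, 0, 1}" "t \<in> {- 4, - 3, - 2, - 1, 0, 1, 2, 3, 4}" by auto
  have "(e, t) \<in> {(0, 2), (0, - 2), (0, 4), (0, - 4), (1, 1), (1, - 1), (- 1, 1), (- 1, - 1)}"
    using et n e2 by (elim insertE emptyE; simp)
  moreover have "x = Complex (of_int t / 2) (of_int e / 2 * sqrt 11)"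
    using t Im' by (simp add: complex_eq_iff)
  ultimately show ?thesis
    by (elim insertE emptyE; simp add: complex_eq_iff \<alpha>_eq)
qed simp

lemma labels_minus: "x \<in> labels d \<Longrightarrow> - x \<in> labels d"
proof -
  have "- y \<in> ring_of_integers d" if y: "y \<in> ring_of_integers d" for y
  proof -
    obtain a b where "y = of_rat a + of_rat b * csqrt (of_int d)"
      using y by (auto simp: ring_of_integers_def quadratic_field_def)
    then have "- y = of_rat (- a) + of_rat (- b) * csqrt (of_int d)"
      by (simp add: of_rat_minus)
    then show ?thesis
      using y unfolding ring_of_integers_def quadratic_field_def by blast
  qed
  then show "x \<in> labels d \<Longrightarrow> - x \<in> labels d"
    by (auto simp: labels_def norm_layer_def)
qed

lemma zero_in_labels: "0 \<in> labels d"
  by (simp add: labels_def)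

lemma one_in_labels: "1 \<in> labels d"
proof -
  have "1 = of_rat 1 + of_rat 0 * csqrt (of_int d)" by simp
  then have "1 \<in> quadratic_field d" unfolding quadratic_field_def by blast
  then show ?thesis
    by (simp add: labels_def norm_layer_def ring_of_integers_def int_imp_algebraic_int)
qed

section \<open>Graphs equivalent to \<open>S\<^sub>4'\<close>\<close>

text \<open>The matrix of \<open>S\<^sub>4'\<close> up to equivalence, with the vertices \<open>1, 2, 3, 4\<close> placed at the
  indices \<open>u, v, w, y\<close>. Positions are free because \<^const>\<open>contained_in\<close> preserves
  the order of the vertices of the smaller graph.\<close>

definition quad_mat :: "nat \<Rightarrow> nat \<Rightarrow> nat \<Rightarrow> nat \<Rightarrow> complex \<Rightarrow> complex \<Rightarrow> complex mat" where
  "quad_mat u v w y x s = mat 4 4 (\<lambda>ij.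
     if ij = (u, v) then x else if ij = (v, u) then cnj x
     else if ij = (w, y) then - (s * x) else if ij = (y, w) then - (s * cnj x)
     else if ij \<in> {(u, w), (w, u)} then s
     else if ij \<in> {(v, y), (y, v)} then 1 else 0)"

locale quad_graph =
  fixes u v w y :: nat and x s :: complex
  assumes uvwy: "distinct [u, v, w, y]" "{u, v, w, y} = {0..<4}"
    and x: "x * cnj x = 3" and s: "s \<in> {1, - 1}"
begin

abbreviation "G \<equiv> quad_mat u v w y x s"

lemma less_4: "u < 4" "v < 4" "w < 4" "y < 4"
  using uvwy(2) by (metis atLeastLessThan_iff insertCI)+

lemma index_4:
  assumes "i < 4" obtains "i = u" | "i = v" | "i = w" | "i = y"
proof -
  have "i \<in> {u, v, w, y}" using assms uvwy(2) by simp
  then show thesis using that by blast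
qed

lemma G_carrier: "G \<in> carrier_mat 4 4"
  by (simp add: quad_mat_def)

lemma entries:
  "G $$ (u, u) = 0" "G $$ (u, v) = x" "G $$ (u, w) = s" "G $$ (u, y) = 0"
  "G $$ (v, u) = cnj x" "G $$ (v, v) = 0" "G $$ (v, w) = 0" "G $$ (v, y) = 1"
  "G $$ (w, u) = s" "G $$ (w, v) = 0" "G $$ (w, w) = 0" "G $$ (w, y) = - (s * x)"
  "G $$ (y, u) = 0" "G $$ (y, v) = 1" "G $$ (y, w) = - (s * cnj x)" "G $$ (y, y) = 0"
  using less_4 uvwy(1) by (auto simp: quad_mat_def)

text \<open>Each row has squared norm 3 + 1. Opposite corners of the four-cycle are joined by two
  paths of length 2, whose contributions cancel because of the minus sign on the edge between w and
  y.\<close>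

lemma G_square: "G * G = 4 \<cdot>\<^sub>m 1\<^sub>m 4"
proof (rule eq_matI)
  fix i j assume "i < dim_row (4 \<cdot>\<^sub>m 1\<^sub>m 4 :: complex mat)" "j < dim_col (4 \<cdot>\<^sub>m 1\<^sub>m 4 :: complex mat)"
  then have ij: "i < 4" "j < 4" by auto
  have "(G * G) $$ (i, j) = (\<Sum>k \<in> {u, v, w, y}. G $$ (i, k) * G $$ (k, j))"
    unfolding uvwy(2) by (rule mult_index_sum[OF G_carrier G_carrier ij])
  also have "\<dots> = G $$ (i, u) * G $$ (u, j) + G $$ (i, v) * G $$ (v, j)
      + G $$ (i, w) * G $$ (w, j) + G $$ (i, y) * G $$ (y, j)"
    using uvwy(1) by (simp add: algebra_simps)
  also have "\<dots> = (if i = j then 4 else 0)"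
    using uvwy(1) x s
    by (rule_tac index_4[OF ij(1)]; rule_tac index_4[OF ij(2)])
      (auto simp: entries algebra_simps)
  finally show "(G * G) $$ (i, j) = (4 \<cdot>\<^sub>m 1\<^sub>m 4) $$ (i, j)"
    using ij by simp
qed (simp_all add: quad_mat_def)

lemma G_cyclotomic: "cyclotomic G"
  unfolding cyclotomic_def
proof (intro allI impI)
  fix k assume "eigenvalue G k"
  then obtain z where z: "z \<in> carrier_vec 4" "z \<noteq> 0\<^sub>v 4" "G *\<^sub>v z = k \<cdot>\<^sub>v z"
    using carrier_matD(1)[OF G_carrier] unfolding eigenvalue_def eigenvector_def by auto
  have "(G * G) *\<^sub>v z = G *\<^sub>v (k \<cdot>\<^sub>v z)"
    using z G_carrier by (metis assoc_mult_mat_vec)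
  also have "\<dots> = k \<cdot>\<^sub>v (k \<cdot>\<^sub>v z)"
    using z mult_mat_vec[OF G_carrier z(1), of k] by simp
  finally have eq: "(4 \<cdot>\<^sub>m 1\<^sub>m 4) *\<^sub>v z = k \<cdot>\<^sub>v (k \<cdot>\<^sub>v z)"
    unfolding G_square .
  obtain i where i: "i < 4" "z $ i \<noteq> 0"
    using z by (metis carrier_vecD dim_vec index_zero_vec(1) index_zero_vec(2) eq_vecI)
  have "((4 \<cdot>\<^sub>m 1\<^sub>m 4) *\<^sub>v z) $ i = (\<Sum>k = 0..<4. if k = i then 4 * z $ k else 0)"
    using i z(1)
    by (auto simp: scalar_prod_def simp del: sum.delta sum.delta' intro!: sum.cong)
  then have "((4 \<cdot>\<^sub>m 1\<^sub>m 4) *\<^sub>v z) $ i = 4 * z $ i"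
    using i by simp
  moreover have "(k \<cdot>\<^sub>v (k \<cdot>\<^sub>v z)) $ i = k * k * z $ i"
    using i z(1) by simp
  ultimately have "4 * z $ i = k * k * z $ i" using eq by metis
  then have "k * k = 4" using i by simp
  then have "(k - 2) * (k + 2) = 0" by (simp add: algebra_simps)
  then have "k = complex_of_real 2 \<or> k = complex_of_real (- 2)"
    by (auto simp: eq_neg_iff_add_eq_0)
  then show "k \<in> complex_of_real ` {- 2..2}" by fastforce
qed

lemma G_connected: "graph_connected G"
proof (rule graph_connectedI[OF G_carrier])
  fix S assume S: "S \<subseteq> {0..<4}" "S \<noteq> {}"
    and closed: "\<And>i j. i \<in> S \<Longrightarrow> j < 4 \<Longrightarrow> j \<notin> S \<Longrightarrow> G $$ (i, j) = 0"
  have ne: "x \<noteq> 0" "s \<noteq> 0" using x s by auto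
  \<comment> \<open>The path w, u, v, y already spans the graph.\<close>
  have "u \<in> S \<longrightarrow> v \<in> S" "v \<in> S \<longrightarrow> u \<in> S" "u \<in> S \<longrightarrow> w \<in> S" "w \<in> S \<longrightarrow> u \<in> S"
    "v \<in> S \<longrightarrow> y \<in> S" "y \<in> S \<longrightarrow> v \<in> S"
    using closed[of u v] closed[of v u] closed[of u w] closed[of w u] closed[of v y]
      closed[of y v] less_4 entries ne by auto
  then show "S = {0..<4}"
    using S unfolding uvwy(2)[symmetric] by blast
qed

lemma G_L_graph:
  assumes l: "x \<in> labels d" "cnj x \<in> labels d"
  shows "L_graph d G"
proof -
  have l1: "0 \<in> labels d" "1 \<in> labels d" "- 1 \<in> labels d" "- x \<in> labels d" "- cnj x \<in> labels d"
    using l zero_in_labels one_in_labels labels_minus by blast+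
  have "G $$ (i, i) = 0" if "i < 4" for i
    using index_4[OF that] entries by metis
  moreover have "G $$ (i, j) \<in> labels d" if "i < 4" "j < 4" for i j
    using s l l1
    by (rule_tac index_4[OF that(1)]; rule_tac index_4[OF that(2)]) (auto simp: entries)
  moreover have "mat_adjoint G = G"
  proof (rule eq_matI)
    show "dim_row (mat_adjoint G) = dim_row G" "dim_col (mat_adjoint G) = dim_col G"
      by (simp_all add: mat_adjoint_def quad_mat_def)
    fix i j assume "i < dim_row G" "j < dim_col G"
    then have ij: "i < 4" "j < 4" using G_carrier by auto
    show "mat_adjoint G $$ (i, j) = G $$ (i, j)"
      unfolding mat_adjoint_index[OF G_carrier ij] using s
      by (rule_tac index_4[OF ij(1)]; rule_tac index_4[OF ij(2)]) (auto simp: entries)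
  qed
  ultimately show ?thesis
    using G_carrier by (auto simp: L_graph_def)
qed

text \<open>\<open>A\<close> is the leading principal submatrix of \<open>G\<close>, a strictly
  larger connected cyclotomic graph.\<close>

lemma not_maximal:
  assumes A: "A \<in> carrier_mat n n" and n: "n < 4"
    and eq: "\<And>i j. i < n \<Longrightarrow> j < n \<Longrightarrow> A $$ (i, j) = G $$ (i, j)"
    and l: "x \<in> labels d" "cnj x \<in> labels d"
  shows "\<not> maximal_connected_cyclotomic d A"
proof -
  \<comment> \<open>\<open>submatrix\<close> enumerates its index set in increasing order, which on
    an initial segment is the identity.\<close>
  have pick: "pick {0..<n} i = i" if "i < n" for i
  proof -
    have "{a \<in> {0..<n}. a < i} = {0..<i}" using that by auto
    then show ?thesis using pick_card_in_set[of i "{0..<n}"] that by simp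
  qed
  have c: "{i. i < 4 \<and> i \<in> {0..<n}} = {0..<n}" using n by auto
  have "A = submatrix G {0..<n} {0..<n}"
    using A G_carrier unfolding submatrix_def
    by (intro eq_matI) (auto simp: c[simplified] pick eq)
  then have "contained_in A G"
    using n G_carrier unfolding contained_in_def by (intro exI[of _ "{0..<n}"]) auto
  then show ?thesis
    using G_L_graph[OF l] G_connected G_cyclotomic n A G_carrier
    unfolding maximal_connected_cyclotomic_def by (metis carrier_matD(1))
qed

end

section \<open>Classification\<close>

locale cyclotomic_graph =
  fixes n :: nat and A :: "complex mat"
  assumes A: "A \<in> carrier_mat n n" and L: "L_graph (- 11) A"
    and cyc: "cyclotomic A" and conn: "graph_connected A"
begin

abbreviation a where "a i j \<equiv> A $$ (i, j)"

lemma herm: "i < n \<Longrightarrow> j < n \<Longrightarrow> a j i = cnj (a i j)"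
  using L A mat_adjoint_index[OF A, of j i] by (simp add: L_graph_def)

lemma hermitian: "hermitian_mat n A"
  unfolding hermitian_mat_def using A herm by blast

lemma entry_cases:
  assumes "i < n" "j < n"
  shows "a i j \<in> {0, 1, - 1, 2, - 2, \<alpha>, - \<alpha>, cnj \<alpha>, - cnj \<alpha>}"
proof (cases "i = j")
  case True
  then show ?thesis using L A assms by (auto simp: L_graph_def)
next
  case False
  then have "a i j \<in> labels (- 11)" using L A assms by (auto simp: L_graph_def)
  then show ?thesis by (rule labels_minus_11)
qed

lemma diag: "i < n \<Longrightarrow> a i i \<in> {0, 1, - 1}"
  using L A by (auto simp: L_graph_def)

lemma partial_row_norm:
  assumes "i < n" "T \<subseteq> {0..<n}"
  shows "(\<Sum>j \<in> T. (cmod (a i j))\<^sup>2) \<le> 4"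
  using sum_mono2[of "{0..<n}" T "\<lambda>j. (cmod (a i j))\<^sup>2"] assms
    cyclotomic_row_norm(1)[OF hermitian cyc assms(1)] by force

lemma entry_of_norm_le_1:
  assumes "i < n" "j < n" "a i j \<noteq> 0" "(cmod (a i j))\<^sup>2 \<le> 1"
  shows "a i j = 1 \<or> a i j = - 1"
  using entry_cases[OF assms(1,2)] assms(3,4) cmod_\<alpha> by auto

lemma norm_4_row:
  assumes "i < n" "j < n" "v < n" "(cmod (a i v))\<^sup>2 = 4" "j \<noteq> v"
  shows "a i j = 0"
  using partial_row_norm[of i "{v, j}"] assms by simp

text \<open>Next to an entry of squared norm 3 the row has room for exactly one unit. Once that is
  present, the squared norm is 4 and orthogonality to every other row involves just two terms. The
  case j = i, where the unit is a charge, is included.\<close>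

lemma norm_3_row:
  assumes i: "i < n" and j: "j < n" and v: "v < n" and three: "(cmod (a i v))\<^sup>2 = 3"
    and jv: "j \<noteq> v" and nz: "a i j \<noteq> 0"
  shows "a i j = 1 \<or> a i j = - 1"
    and "k < n \<Longrightarrow> k \<noteq> v \<Longrightarrow> k \<noteq> j \<Longrightarrow> a i k = 0"
    and "k < n \<Longrightarrow> k \<noteq> i \<Longrightarrow> a i v * a v k + a i j * a j k = 0"
proof -
  have "(cmod (a i j))\<^sup>2 \<le> 1"
    using partial_row_norm[of i "{v, j}"] assms by simp
  then show ij: "a i j = 1 \<or> a i j = - 1"
    by (rule entry_of_norm_le_1[OF i j nz])
  then have one: "(cmod (a i j))\<^sup>2 = 1" by auto
  have zero: "a i k = 0" if "k < n" "k \<noteq> v" "k \<noteq> j" for k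
    using partial_row_norm[of i "{v, j, k}"] assms that one by simp
  then show "k < n \<Longrightarrow> k \<noteq> v \<Longrightarrow> k \<noteq> j \<Longrightarrow> a i k = 0" .
  \<comment> \<open>Stated for a general f so that it serves both the real sum of squared norms and
    the complex entries of \<open>A * A\<close>.\<close>
  have sub: "(\<Sum>k = 0..<n. f (a i k) k) = f (a i v) v + f (a i j) j"
    if "\<And>k. f 0 k = 0" for f :: "complex \<Rightarrow> nat \<Rightarrow> 'b :: comm_monoid_add"
  proof -
    have "(\<Sum>k = 0..<n. f (a i k) k) = (\<Sum>k \<in> {v, j}. f (a i k) k)"
      by (rule sum.mono_neutral_right) (use v j zero that in auto)
    then show ?thesis using jv by simp
  qed
  have four: "(\<Sum>k = 0..<n. (cmod (a i k))\<^sup>2) = 4"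
    using sub[of "\<lambda>x k. (cmod x)\<^sup>2"] three one by simp
  assume k: "k < n" "k \<noteq> i"
  have "(A * A) $$ (i, k) = a i v * a v k + a i j * a j k"
    unfolding mult_index_sum[OF A A i k(1)] by (rule sub[of "\<lambda>x l. x * a l k"]) simp
  then show "a i v * a v k + a i j * a j k = 0"
    using cyclotomic_row_norm(2)[OF hermitian cyc i four k] by simp
qed

lemma closed_set:
  assumes "T \<subseteq> {0..<n}" "T \<noteq> {}" "\<And>i j. i \<in> T \<Longrightarrow> j < n \<Longrightarrow> j \<notin> T \<Longrightarrow> a i j = 0"
  shows "T = {0..<n}"
proof (rule graph_connected_closed_subset[OF A conn assms(1,2)])
  fix i j assume ij: "i \<in> T" "j < n" "j \<notin> T"
  then have "a i j = 0" "i < n" using assms by auto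
  then show "a i j = 0 \<and> a j i = 0" using herm[of i j] ij by simp
qed

section \<open>Cases by the norm of an edge and its surroundings\<close>

lemma norm_4_equivalent:
  assumes u: "u < n" and v: "v < n" and e: "a u v = e * 2" "e \<in> {1, - 1}"
  shows "equivalent A S2"
proof -
  have uv: "u \<noteq> v" using diag[OF u] e by auto
  have vu: "a v u = e * 2" using herm[OF u v] e by auto
  have nrm: "(cmod (a u v))\<^sup>2 = 4" "(cmod (a v u))\<^sup>2 = 4" using e vu by auto
  have set: "{u, v} = {0..<n}"
    by (rule closed_set) (use u v norm_4_row[OF u _ v nrm(1)] norm_4_row[OF v _ u nrm(2)] in auto)
  then have n: "n = 2" using uv by (metis card_2_iff card_atLeastLessThan diff_zero)
  have z: "a u u = 0" "a v v = 0"
    using norm_4_row[OF u u v nrm(1)] norm_4_row[OF v v u nrm(2)] uv by auto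
  have C: "S2 \<in> carrier_mat n n" by (rule carrier_matI) (simp_all add: S2_def n mat_of_rows_list_def)
  show ?thesis
  proof (rule equivalentI[OF A C, where X = A and xs = "[u, v]" and d = "(!) [1, e]"])
    fix i j assume "i < n" "j < n"
    then have "i = 0 \<or> i = 1" "j = 0 \<or> j = 1" using n by auto
    then show "S2 $$ (i, j) = [1, e] ! i * [1, e] ! j * a ([u, v] ! i) ([u, v] ! j)"
      using e vu z by (auto simp: S2_def mat_of_rows_list_def)
  next
    fix i assume "i < n"
    then have "i = 0 \<or> i = 1" using n by auto
    then show "[1, e] ! i \<in> {1, - 1}" using e by auto
  qed (use set uv in auto)
qed

text \<open>Orthogonality of rows u and v reads \<open>a u v * (a v v + a u u) = 0\<close>, so the
  charges are opposite. Both rows are then full, and no third vertex can be attached.\<close>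

lemma charged_equivalent:
  assumes u: "u < n" and v: "v < n" and e: "a u v = e * \<alpha>" "e \<in> {1, - 1}"
    and uv: "u \<noteq> v" and ch: "a u u \<noteq> 0"
  shows "equivalent A S2'"
proof -
  have vu: "a v u = e * cnj \<alpha>" using herm[OF u v] e by auto
  have nrm: "(cmod (a u v))\<^sup>2 = 3" "(cmod (a v u))\<^sup>2 = 3"
    using e vu cmod_\<alpha> by auto
  have nz: "a u v \<noteq> 0" using nrm by auto
  have "a u v * a v v + a u u * a u v = 0"
    by (rule norm_3_row(3)[OF u u v nrm(1) uv ch v]) (use uv in simp)
  then have "a u v * (a v v + a u u) = 0" by (simp add: algebra_simps)
  then have vv: "a v v = - a u u" using nz by (simp add: eq_neg_iff_add_eq_0)
  then have chv: "a v v \<noteq> 0" using ch by simp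
  have set: "{u, v} = {0..<n}"
  proof (rule closed_set)
    fix i j assume "i \<in> {u, v}" "j < n" "j \<notin> {u, v}"
    then show "a i j = 0"
      using norm_3_row(2)[OF u u v nrm(1) uv ch, of j]
        norm_3_row(2)[OF v v u nrm(2) uv[symmetric] chv, of j] by auto
  qed (use u v in auto)
  then have n: "n = 2" using uv by (metis card_2_iff card_atLeastLessThan diff_zero)
  have C: "S2' \<in> carrier_mat n n" by (rule carrier_matI) (simp_all add: S2'_def n mat_of_rows_list_def)
  define c where "c = a u u"
  have c: "c \<in> {1, - 1}" using diag[OF u] ch by (auto simp: c_def)
  show ?thesis
  \<comment> \<open>Negation, when needed, makes the charge of u positive and turns the label into
    \<open>c * e * \<alpha>\<close>; the sign \<open>c * e\<close> at v then removes the remaining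
    factor.\<close>
  proof (rule equivalentI[OF A C, where X = "if c = 1 then A else - A" and xs = "[u, v]"
        and d = "(!) [1, c * e]"])
    fix i j assume "i < n" "j < n"
    then have "i = 0 \<or> i = 1" "j = 0 \<or> j = 1" using n by auto
    then show "S2' $$ (i, j) = [1, c * e] ! i * [1, c * e] ! j *
        (if c = 1 then A else - A) $$ ([u, v] ! i, [u, v] ! j)"
      using e vu vv c u v A unfolding c_def by (auto simp: S2'_def mat_of_rows_list_def)
  next
    fix i assume "i < n"
    then have "i = 0 \<or> i = 1" using n by auto
    then show "[1, c * e] ! i \<in> {1, - 1}" using e c by auto
  qed (use set uv in auto)
qed

lemma labels_norm_3:
  assumes "i < n" "j < n" "(cmod (a i j))\<^sup>2 = 3"
  shows "a i j \<in> labels (- 11)"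
proof -
  have "i \<noteq> j" using diag[OF assms(1)] assms(3) by auto
  then show ?thesis using L A assms by (auto simp: L_graph_def)
qed

text \<open>The vertex v is an uncharged leaf. Either u has no other neighbour, or it has exactly
  one, again an uncharged leaf. In both cases the missing corners of a four-cycle can be appended as
  last indices.\<close>

lemma norm_3_not_maximal:
  assumes u: "u < n" and v: "v < n" and uv: "u \<noteq> v" and three: "(cmod (a u v))\<^sup>2 = 3"
    and z: "\<And>k. k < n \<Longrightarrow> k \<noteq> u \<Longrightarrow> a v k = 0" "a u u = 0"
  shows "\<not> maximal_connected_cyclotomic (- 11) A"
proof -
  define x where "x = a u v"
  have x: "x * cnj x = 3" using three by (simp add: x_def complex_norm_square[symmetric])
  have vu: "a v u = cnj x" using herm[OF u v] by (simp add: x_def)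
  have l: "x \<in> labels (- 11)" "cnj x \<in> labels (- 11)"
    using labels_norm_3[OF u v three] labels_norm_3[OF v u] three vu by (auto simp: x_def)
  have vv: "a v v = 0" using z v uv by metis
  show ?thesis
  proof (cases "\<exists>w < n. w \<noteq> v \<and> a u w \<noteq> 0")
    case False
    have set: "{u, v} = {0..<n}"
    proof (rule closed_set)
      fix i j assume "i \<in> {u, v}" "j < n" "j \<notin> {u, v}"
      then show "a i j = 0" using False z by auto
    qed (use u v in auto)
    then have n: "n = 2" using uv by (metis card_2_iff card_atLeastLessThan diff_zero)
    have "{0..<4} = {0..<2} \<union> {2, 3 :: nat}" by auto
    \<comment> \<open>The new vertices take the indices 2 and 3; their sign is a free
      choice.\<close>
    then interpret quad_graph u v 2 3 x 1
      by unfold_locales (use set n u v uv x in auto)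
    show ?thesis
    proof (rule not_maximal[OF A _ _ l])
      fix i j assume "i < n" "j < n"
      then have "i \<in> {u, v}" "j \<in> {u, v}" using set by auto
      then show "a i j = G $$ (i, j)"
        by (elim insertE emptyE; simp add: entries z(2) vv vu x_def[symmetric])
    qed (use n in simp)
  next
    case True
    then obtain w where w: "w < n" "w \<noteq> v" "a u w \<noteq> 0" by blast
    have wu: "w \<noteq> u" using w z by auto
    note row = norm_3_row[OF u w(1) v three w(2,3)]
    have s: "a u w \<in> {1, - 1}" using row(1) by auto
    have wuu: "a w u = a u w" using herm[OF u w(1)] s by auto
    \<comment> \<open>Orthogonality of rows u and k, where the term through v vanishes because v is
      a leaf.\<close>
    have wk: "a w k = 0" if "k < n" "k \<noteq> u" for k
      using row(3)[OF that] z(1)[OF that] w by simp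
    have set: "{u, v, w} = {0..<n}"
    proof (rule closed_set)
      fix i j assume "i \<in> {u, v, w}" "j < n" "j \<notin> {u, v, w}"
      then show "a i j = 0" using row(2)[of j] z wk by auto
    qed (use u v w in auto)
    have "card {u, v, w} = 3" using uv w wu by auto
    then have n: "n = 3" unfolding set by simp
    have "{0..<4} = {0..<3} \<union> {3 :: nat}" by auto
    then interpret quad_graph u v w 3 x "a u w"
      by unfold_locales (use set n u v uv w wu x s in auto)
    show ?thesis
    proof (rule not_maximal[OF A _ _ l])
      fix i j assume "i < n" "j < n"
      then have "i \<in> {u, v, w}" "j \<in> {u, v, w}" using set by auto
      then show "a i j = G $$ (i, j)"
        by (elim insertE emptyE; simp add: entries z(2) vv vu wuu wk[OF w(1) wu]
            wk[OF v uv[symmetric]] z(1)[OF w(1) wu] x_def[symmetric])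
    qed (use n in simp)
  qed
qed

lemma uncharged_equivalent:
  assumes u: "u < n" and v: "v < n" and e: "a u v = e * \<alpha>" "e \<in> {1, - 1}"
    and uv: "u \<noteq> v" and z: "a u u = 0" "a v v = 0"
    and w: "w < n" "w \<noteq> v" "a u w \<noteq> 0" and y: "y < n" "y \<noteq> u" "a v y \<noteq> 0"
  shows "equivalent A S4'"
proof -
  have vu: "a v u = e * cnj \<alpha>" using herm[OF u v] e by auto
  have nrm: "(cmod (a u v))\<^sup>2 = 3" "(cmod (a v u))\<^sup>2 = 3"
    using e vu cmod_\<alpha> by auto
  note rowu = norm_3_row[OF u w(1) v nrm(1) w(2,3)]
  note rowv = norm_3_row[OF v y(1) u nrm(2) y(2,3)]
  define s where "s = a u w"
  define t where "t = a v y"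
  have st: "s \<in> {1, - 1}" "t \<in> {1, - 1}" using rowu(1) rowv(1) by (auto simp: s_def t_def)
  have wu: "w \<noteq> u" and yv: "y \<noteq> v" using w y z by auto
  \<comment> \<open>Orthogonality of rows u and v excludes a triangle, so w and y are
    distinct.\<close>
  have wv: "a w v = 0" using rowu(3)[OF v uv[symmetric]] z w by simp
  have yw: "y \<noteq> w" using herm[OF w(1) v] wv y by auto
  have uy: "a u y = 0" by (rule rowu(2)[OF y(1) yv yw])
  have vw: "a v w = 0" by (rule rowv(2)[OF w(1) wu yw[symmetric]])
  \<comment> \<open>Orthogonality of rows u and y forces the fourth edge and its label.\<close>
  have "a u v * a v y + s * a w y = 0" using rowu(3)[OF y(1,2)] by (simp add: s_def)
  then have "s * (e * \<alpha> * t + s * a w y) = 0" by (simp add: e(1) t_def)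
  then have "s * s * a w y + s * t * e * \<alpha> = 0" by (simp add: algebra_simps)
  moreover have "s * s = 1" using st by auto
  ultimately have wy: "a w y = - (s * t * e * \<alpha>)" by (simp add: eq_neg_iff_add_eq_0)
  have ww: "a w w = 0" using rowu(3)[OF w(1) wu] vw w by simp
  have yw': "a y w = - (s * t * e * cnj \<alpha>)"
    using herm[OF w(1) y(1)] wy st e by auto
  have yy: "a y y = 0"
    using rowv(3)[OF y(1) yv] uy y by simp
  have wu': "a w u = s" and yv': "a y v = t"
    using herm[OF u w(1)] herm[OF v y(1)] st by (auto simp: s_def t_def)
  have yu: "a y u = 0" using herm[OF u y(1)] uy by simp
  have nrm': "(cmod (a w y))\<^sup>2 = 3" "(cmod (a y w))\<^sup>2 = 3"
    using wy yw' st e cmod_\<alpha> by auto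
  have set: "{u, v, w, y} = {0..<n}"
  proof (rule closed_set)
    fix i j assume "i \<in> {u, v, w, y}" "j < n" "j \<notin> {u, v, w, y}"
    then show "a i j = 0"
      using rowu(2)[of j] rowv(2)[of j]
        norm_3_row(2)[OF w(1) u y(1) nrm'(1) y(2)[symmetric], of j]
        norm_3_row(2)[OF y(1) v w(1) nrm'(2) w(2)[symmetric], of j] wu' yv' st by auto
  qed (use u v w y in auto)
  have dist: "distinct [u, v, w, y]" using uv w y wu yv yw by auto
  have "card {u, v, w, y} = 4" using dist by auto
  then have n: "n = 4" unfolding set by simp
  have C: "S4' \<in> carrier_mat n n" by (rule carrier_matI) (simp_all add: S4'_def n mat_of_rows_list_def)
  show ?thesis
  \<comment> \<open>The signs normalise the edges of the spanning path w, u, v, y; the closing edge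
    then automatically has label \<open>- \<alpha>\<close>.\<close>
  proof (rule equivalentI[OF A C, where X = A and xs = "[u, v, w, y]" and d = "(!) [1, e, s, t * e]"])
    fix i j assume "i < n" "j < n"
    then have "i \<in> {0, 1, 2, 3}" "j \<in> {0, 1, 2, 3}" using n by auto
    then show "S4' $$ (i, j) = [1, e, s, t * e] ! i * [1, e, s, t * e] ! j *
        a ([u, v, w, y] ! i) ([u, v, w, y] ! j)"
      using e(2) st
      by (elim insertE emptyE; simp add: S4'_def mat_of_rows_list_def numeral_3_eq_3
          e(1) vu z uy vw wv wy ww yw' yy wu' yv' yu s_def[symmetric] t_def[symmetric])
  next
    fix i assume "i < n"
    then have "i \<in> {0, 1, 2, 3}" using n by auto
    then show "[1, e, s, t * e] ! i \<in> {1, - 1}"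
      using e st by (auto simp: numeral_3_eq_3)
  qed (use set dist in auto)
qed

lemma norm_3_equivalent:
  assumes u: "u < n" and v: "v < n" and e: "a u v = e * \<alpha>" "e \<in> {1, - 1}"
    and max: "maximal_connected_cyclotomic (- 11) A"
  shows "equivalent A S2' \<or> equivalent A S4'"
proof -
  have vu: "a v u = e * cnj \<alpha>" using herm[OF u v] e by auto
  have nrm: "(cmod (a u v))\<^sup>2 = 3" "(cmod (a v u))\<^sup>2 = 3"
    using e vu cmod_\<alpha> by auto
  have uv: "u \<noteq> v" using diag[OF u] nrm by auto
  show ?thesis
  proof (cases "a u u = 0")
    case False
    then show ?thesis using charged_equivalent[OF u v e uv] by simp
  next
    case uu: True
    \<comment> \<open>A charge at v would fill row v, and orthogonality to row u would require a
      charge at u as well.\<close>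
    have vv: "a v v = 0"
    proof (rule ccontr)
      assume ch: "a v v \<noteq> 0"
      have "a v u * a u u + a v v * a v u = 0"
        by (rule norm_3_row(3)[OF v v u nrm(2) uv[symmetric] ch u uv])
      then show False using uu ch nrm by auto
    qed
    have "\<exists>w < n. w \<noteq> v \<and> a u w \<noteq> 0"
      using norm_3_not_maximal[OF v u uv[symmetric] nrm(2)] vv max by blast
    moreover have "\<exists>y < n. y \<noteq> u \<and> a v y \<noteq> 0"
      using norm_3_not_maximal[OF u v uv nrm(1)] uu max by blast
    ultimately show ?thesis
      using uncharged_equivalent[OF u v e uv uu vv] by blast
  qed
qed

end

lemma equivalent_refl:
  assumes "A \<in> carrier_mat n n"
  shows "equivalent A A"
  by (rule equivalentI[OF assms assms, where X = A and xs = "[0..<n]" and d = "\<lambda>_. 1"]) auto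

theorem theorem6:
  fixes A :: "complex mat"
  assumes "maximal_connected_cyclotomic (- 11) A"
    and "\<not> (\<exists>B. charged_signed_graph (- 11) B \<and> equivalent A B)"
  shows "equivalent A S2 \<or> equivalent A S2' \<or> equivalent A S4'"
proof -
  define n where "n = dim_row A"
  have LA: "L_graph (- 11) A" using assms(1) by (simp add: maximal_connected_cyclotomic_def)
  then have A: "A \<in> carrier_mat n n" by (auto simp: L_graph_def n_def)
  interpret cyclotomic_graph n A
    using A assms(1) by unfold_locales (auto simp: maximal_connected_cyclotomic_def)
  have "\<not> charged_signed_graph (- 11) A"
    using equivalent_refl[OF A] assms(2) by blast
  then obtain u v where u: "u < n" and v: "v < n" and uv: "a u v \<notin> {0, 1, - 1}"
    using LA unfolding charged_signed_graph_def n_def by blast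
  from uv entry_cases[OF u v]
  consider "a u v \<in> {2, - 2}" | "a u v \<in> {\<alpha>, - \<alpha>}" | "a u v \<in> {cnj \<alpha>, - cnj \<alpha>}"
    by blast
  then show ?thesis
  proof cases
    case 1
    then have "\<exists>e \<in> {1, - 1}. a u v = e * 2" by simp
    then show ?thesis using norm_4_equivalent[OF u v] by blast
  next
    case 2
    then have "\<exists>e \<in> {1, - 1}. a u v = e * \<alpha>" by simp
    then show ?thesis using norm_3_equivalent[OF u v] assms(1) by blast
  next
    case 3
    \<comment> \<open>Reading the edge from its other end conjugates the label.\<close>
    then have "\<exists>e \<in> {1, - 1}. a v u = e * \<alpha>" using herm[OF u v] by auto
    then show ?thesis using norm_3_equivalent[OF v u] assms(1) by blast
  qed
qed

end
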